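(* Suppose that $\Psi$ is countable with $\nu_\Psi$ equal to counting measure and that $\pi_\Psi(\psi)>0$ for every $\psi\in\Psi$. For $\eta>0$ let $L_{\eta,\gamma}(x)$ be the $\gamma$-lowest posterior loss region for the loss function $$L_\eta(\theta,\psi)=\frac{I(\Psi(\theta)\neq\psi)}{\max(\eta,\pi_\Psi(\Psi(\theta)))}.$$ Then $C_\gamma(x)\subset\liminf_{\eta\to0}L_{\eta,\gamma}(x)$ whenever $\gamma\in[0,1]$ is such that $\Pi_\Psi(C_\gamma(x)\,|\,x)=\gamma$; and $\limsup_{\eta\to0}L_{\eta,\gamma}(x)\subset C_{\gamma'}(x)$ whenever $\gamma'>\gamma$ and $\Pi_\Psi(C_{\gamma'}(x)\,|\,x)=\gamma'$.
   Context: Setting: $\{f_\theta:\theta\in\Theta\}$ is a family of probability densities with respect to a support measure $\mu$ on a sample space $\mathcal X$. $\Pi$ is a proper prior (probability measure) on $\Theta$ with density $\pi$ with respect to a support measure $\nu$. Put $m(x)=\int_\Theta \pi(\theta)f_\theta(x)\,\nu(d\theta)$. The posterior $\Pi(\cdot\,|\,x)$ has density $\pi(\theta)f_\theta(x)/m(x)$ with respect to $\nu$ (for $x$ with $0<m(x)<\infty$). A (measurable) map $\Psi:\Theta\to\Psi$ is given; the same symbol $\Psi$ denotes the map and its target space. $\Pi_\Psi$ and $\Pi_\Psi(\cdot\,|\,x)$ are the marginal prior and marginal posterior of $\psi=\Psi(\theta)$, with densities $\pi_\Psi$ and $\pi_\Psi(\cdot\,|\,x)$ with respect to a support measure $\nu_\Psi$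 on $\Psi$. $I(\cdot)$ is the indicator; $\gamma,\gamma'\in[0,1]$. The $\gamma$-relative surprise region is $C_\gamma(x)=\{\psi:\pi_\Psi(\psi\,|\,x)/\pi_\Psi(\psi)\geq c_\gamma(x)\}$ with $c_\gamma(x)=\sup\{k:\Pi_\Psi(\{\psi:\pi_\Psi(\psi\,|\,x)/\pi_\Psi(\psi)\geq k\}\,|\,x)\geq\gamma\}$. In general a $\gamma$-lowest posterior loss region is the set of $\psi$ whose posterior risk is at most the smallest cutoff giving posterior content at least $\gamma$. For the loss $L_\eta$ it takes the form $$L_{\eta,\gamma}(x)=\{\psi:\pi_\Psi(\psi\,|\,x)/\max(\eta,\pi_\Psi(\psi))\geq l_{\eta,\gamma}(x)\},$$ where $l_{\eta,\gamma}(x)=\sup\{k:\Pi_\Psi(\{\psi:\pi_\Psi(\psi\,|\,x)/\max(\eta,\pi_\Psi(\psi))\geq k\}\,|\,x)\geq\gamma\}$. In these suprema $k$ ranges over the real numbers and the value $+\infty$ is allowed. For sets $A_\eta$ indexed by $\eta>0$: $\liminf_{\eta\to0}A_\eta=\bigcup_{\eta_0>0}\bigcap_{0<\eta<\eta_0}A_\eta$ and $\limsup_{\eta\to0}A_\eta=\bigcap_{\eta_0>0}\bigcup_{0<\eta<\eta_0}A_\eta$. *)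

theory Defs
  imports "HOL-Probability.Probability"
begin

definition prior :: "'t measure \<Rightarrow> ('t \<Rightarrow> real) \<Rightarrow> 't measure" where
  "prior \<nu> w = density \<nu> (\<lambda>\<theta>. ennreal (w \<theta>))"

definition prior_predictive ::
  "'t measure \<Rightarrow> ('t \<Rightarrow> real) \<Rightarrow> ('t \<Rightarrow> 'x \<Rightarrow> real) \<Rightarrow> 'x \<Rightarrow> ennreal" where
  "prior_predictive \<nu> w f x = (\<integral>\<^sup>+\<theta>. ennreal (w \<theta> * f \<theta> x) \<partial>\<nu>)"

definition posterior ::
  "'t measure \<Rightarrow> ('t \<Rightarrow> real) \<Rightarrow> ('t \<Rightarrow> 'x \<Rightarrow> real) \<Rightarrow> 'x \<Rightarrow> 't measure" where
  "posterior \<nu> w f x =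
     density \<nu> (\<lambda>\<theta>. ennreal (w \<theta> * f \<theta> x) / prior_predictive \<nu> w f x)"

(* The parameter space is space \<nu>, the sample space is space \<mu>, and the target space of \<Psi>
   is space \<nu>\<Psi>. The functions p and q x are the densities of the marginal prior and of the
   marginal posterior of \<Psi> with respect to \<nu>\<Psi>. Only the measurability in \<theta> that is
   needed for the prior predictive density is required, not joint measurability of f. *)
locale bayes_model =
  fixes \<mu> :: "'x measure"
    and f :: "'t \<Rightarrow> 'x \<Rightarrow> real"
    and \<nu> :: "'t measure"
    and w :: "'t \<Rightarrow> real"
    and \<nu>\<Psi> :: "'p measure"
    and \<Psi> :: "'t \<Rightarrow> 'p"
    and p :: "'p \<Rightarrow> real"
    and q :: "'x \<Rightarrow> 'p \<Rightarrow> real"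
  assumes f_nonneg: "\<theta> \<in> space \<nu> \<Longrightarrow> x \<in> space \<mu> \<Longrightarrow> 0 \<le> f \<theta> x"
    and f_measurable: "\<theta> \<in> space \<nu> \<Longrightarrow> f \<theta> \<in> borel_measurable \<mu>"
    and f_prob: "\<theta> \<in> space \<nu> \<Longrightarrow> prob_space (density \<mu> (\<lambda>x. ennreal (f \<theta> x)))"
    and f_measurable_param: "x \<in> space \<mu> \<Longrightarrow> (\<lambda>\<theta>. f \<theta> x) \<in> borel_measurable \<nu>"
    and w_nonneg: "\<theta> \<in> space \<nu> \<Longrightarrow> 0 \<le> w \<theta>"
    and w_measurable: "w \<in> borel_measurable \<nu>"
    and prior_prob: "prob_space (prior \<nu> w)"
    and \<Psi>_measurable: "\<Psi> \<in> measurable \<nu> \<nu>\<Psi>"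
    and p_nonneg: "\<psi> \<in> space \<nu>\<Psi> \<Longrightarrow> 0 \<le> p \<psi>"
    and p_density: "distributed (prior \<nu> w) \<nu>\<Psi> \<Psi> (\<lambda>\<psi>. ennreal (p \<psi>))"
    and q_nonneg: "x \<in> space \<mu> \<Longrightarrow> \<psi> \<in> space \<nu>\<Psi> \<Longrightarrow> 0 \<le> q x \<psi>"
    and q_density: "x \<in> space \<mu> \<Longrightarrow> 0 < prior_predictive \<nu> w f x \<Longrightarrow>
          prior_predictive \<nu> w f x < \<infinity> \<Longrightarrow>
          distributed (posterior \<nu> w f x) \<nu>\<Psi> \<Psi> (\<lambda>\<psi>. ennreal (q x \<psi>))"

(* In the next two definitions Q is the marginal posterior; cutoffs range over the reals,
   suprema and infima are taken in the extended reals. For \<gamma> = 0 the cutoff is \<infinity> and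
   the region is empty. *)
definition relative_surprise_cutoff ::
  "'p measure \<Rightarrow> ('p \<Rightarrow> real) \<Rightarrow> ('p \<Rightarrow> real) \<Rightarrow> real \<Rightarrow> ereal" where
  "relative_surprise_cutoff Q p q \<gamma> =
     Sup (ereal ` {k. measure Q {\<psi> \<in> space Q. q \<psi> / p \<psi> \<ge> k} \<ge> \<gamma>})"

definition relative_surprise_region ::
  "'p measure \<Rightarrow> ('p \<Rightarrow> real) \<Rightarrow> ('p \<Rightarrow> real) \<Rightarrow> real \<Rightarrow> 'p set" where
  "relative_surprise_region Q p q \<gamma> =
     {\<psi> \<in> space Q. ereal (q \<psi> / p \<psi>) \<ge> relative_surprise_cutoff Q p q \<gamma>}"

(* Posterior risk of reporting \<psi> for a nonnegative loss; it may be infinite. *)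
definition posterior_risk :: "'t measure \<Rightarrow> ('t \<Rightarrow> 'p \<Rightarrow> real) \<Rightarrow> 'p \<Rightarrow> ereal" where
  "posterior_risk P L \<psi> = enn2ereal (\<integral>\<^sup>+\<theta>. ennreal (L \<theta> \<psi>) \<partial>P)"

definition lowest_posterior_loss_cutoff ::
  "'t measure \<Rightarrow> 'p measure \<Rightarrow> ('t \<Rightarrow> 'p \<Rightarrow> real) \<Rightarrow> real \<Rightarrow> ereal" where
  "lowest_posterior_loss_cutoff P Q L \<gamma> =
     Inf (ereal ` {k. measure Q {\<psi> \<in> space Q. posterior_risk P L \<psi> \<le> ereal k} \<ge> \<gamma>})"

(* P is the posterior and Q the marginal posterior. For \<gamma> = 0 the cutoff is -\<infinity> and the
   region is empty. *)
definition lowest_posterior_loss_region ::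
  "'t measure \<Rightarrow> 'p measure \<Rightarrow> ('t \<Rightarrow> 'p \<Rightarrow> real) \<Rightarrow> real \<Rightarrow> 'p set" where
  "lowest_posterior_loss_region P Q L \<gamma> =
     {\<psi> \<in> space Q. posterior_risk P L \<psi> \<le> lowest_posterior_loss_cutoff P Q L \<gamma>}"

definition truncated_loss ::
  "('t \<Rightarrow> 'p) \<Rightarrow> ('p \<Rightarrow> real) \<Rightarrow> real \<Rightarrow> 't \<Rightarrow> 'p \<Rightarrow> real" where
  "truncated_loss \<Psi> p \<eta> \<theta> \<psi> = of_bool (\<Psi> \<theta> \<noteq> \<psi>) / max \<eta> (p (\<Psi> \<theta>))"

definition set_liminf0 :: "(real \<Rightarrow> 'a set) \<Rightarrow> 'a set" where
  "set_liminf0 A = (\<Union>\<eta>0\<in>{0<..}. \<Inter>\<eta>\<in>{0<..<\<eta>0}. A \<eta>)"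

definition set_limsup0 :: "(real \<Rightarrow> 'a set) \<Rightarrow> 'a set" where
  "set_limsup0 A = (\<Inter>\<eta>0\<in>{0<..}. \<Union>\<eta>\<in>{0<..<\<eta>0}. A \<eta>)"

lemma ereal_refl_Inf:
  fixes S :: "real set" shows "Inf (ereal ` (\<lambda>k. K - k) ` S) = ereal K - Sup (ereal ` S)"
proof -
  have "Inf (ereal ` (\<lambda>k. K - k) ` S) = (INF k\<in>S. ereal K - ereal k)"
    by (simp add: image_comp comp_def)
  also have "\<dots> = ereal K - (SUP k\<in>S. ereal k)"
  proof (cases "S = {}")
    case True then show ?thesis by (simp add: top_ereal_def bot_ereal_def)
  next
    case False then show ?thesis
      by (subst INF_ereal_minus_right) auto
  qed
  finally show ?thesis .
qed

(* The explicit form of the region for a discrete target space. *)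
lemma (in bayes_model) lowest_posterior_loss_region_truncated:
  fixes x \<eta> \<gamma>
  defines "P \<equiv> posterior \<nu> w f x"
  defines "Q \<equiv> distr P \<nu>\<Psi> \<Psi>"
  defines "r \<equiv> \<lambda>\<psi>. q x \<psi> / max \<eta> (p \<psi>)"
  assumes cnt: "\<nu>\<Psi> = count_space (space \<nu>\<Psi>)"
    and x: "x \<in> space \<mu>" "0 < prior_predictive \<nu> w f x" "prior_predictive \<nu> w f x < \<infinity>"
    and \<eta>: "0 < \<eta>"
  shows "lowest_posterior_loss_region P Q (truncated_loss \<Psi> p \<eta>) \<gamma> =
    {\<psi> \<in> space \<nu>\<Psi>. ereal (r \<psi>) \<ge> Sup (ereal ` {k. measure Q {\<psi> \<in> space \<nu>\<Psi>. r \<psi> \<ge> k} \<ge> \<gamma>})}"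
proof -
  let ?d = "\<lambda>\<theta>. 1 / max \<eta> (p (\<Psi> \<theta>))"
  have dist: "distributed P \<nu>\<Psi> \<Psi> (\<lambda>\<psi>. ennreal (q x \<psi>))"
    unfolding P_def by (rule q_density) (use x in auto)
  have sP: "space P = space \<nu>" "sets P = sets \<nu>" by (auto simp: P_def posterior_def)
  have \<Psi>P[measurable]: "\<Psi> \<in> measurable P \<nu>\<Psi>" using dist by (simp add: distributed_def)
  have sing: "{\<psi>} \<in> sets \<nu>\<Psi>" if "\<psi> \<in> space \<nu>\<Psi>" for \<psi>
    using cnt that by (metis sets_count_space Pow_iff empty_subsetI insert_subset)
  have meas: "g \<in> borel_measurable \<nu>\<Psi>" for g :: "'p \<Rightarrow> real"
    by (subst cnt) simp
  have P1: "emeasure P (space P) = 1"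
  proof -
    have m: "(\<lambda>\<theta>. ennreal (w \<theta> * f \<theta> x)) \<in> borel_measurable \<nu>"
      using w_measurable f_measurable_param[OF x(1)] by measurable
    then show ?thesis
      using x unfolding P_def posterior_def
      by (simp add: emeasure_density prior_predictive_def[symmetric] nn_integral_divide ennreal_divide_self
            cong: nn_integral_cong)
  qed
  define T where "T = (\<integral>\<^sup>+\<theta>. ennreal (?d \<theta>) \<partial>P)"
  have dm: "(\<lambda>\<theta>. ennreal (?d \<theta>)) \<in> borel_measurable P"
    using measurable_compose[OF \<Psi>P meas[of "\<lambda>\<psi>. 1 / max \<eta> (p \<psi>)"]] by simp
  have "T \<le> (\<integral>\<^sup>+\<theta>. ennreal (1 / \<eta>) \<partial>P)"
    unfolding T_def using \<eta> by (intro nn_integral_mono ennreal_leI divide_left_mono) auto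
  also have "\<dots> < \<infinity>" using P1 by (simp add: ennreal_less_top)
  finally have Tfin: "T < \<infinity>" .
  define K where "K = enn2real T"
  have TK: "T = ennreal K" using Tfin by (simp add: K_def)
  have K0: "0 \<le> K" by (simp add: K_def)
  have risk: "posterior_risk P (truncated_loss \<Psi> p \<eta>) \<psi> = ereal (K - r \<psi>)" if \<psi>: "\<psi> \<in> space \<nu>\<Psi>" for \<psi>
  proof -
    let ?A = "\<Psi> -` {\<psi>} \<inter> space P"
    have A: "?A \<in> sets P" using \<Psi>P sing[OF \<psi>] by (rule measurable_sets)
    let ?R = "\<integral>\<^sup>+\<theta>. ennreal (truncated_loss \<Psi> p \<eta> \<theta> \<psi>) \<partial>P"
    have "emeasure P ?A = emeasure (distr P \<nu>\<Psi> \<Psi>) {\<psi>}"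
      using sing[OF \<psi>] by (simp add: emeasure_distr)
    also have "\<dots> = emeasure (density \<nu>\<Psi> (\<lambda>\<psi>. ennreal (q x \<psi>))) {\<psi>}"
      using dist by (simp add: distributed_def)
    also have "\<dots> = (\<integral>\<^sup>+y. ennreal (q x y) * indicator {\<psi>} y \<partial>count_space (space \<nu>\<Psi>))"
      using sing[OF \<psi>] meas by (subst emeasure_density) (auto simp flip: cnt)
    also have "\<dots> = ennreal (q x \<psi>)"
      using \<psi> by (subst nn_integral_count_space'[of "{\<psi>}"]) (auto simp: indicator_def)
    finally have eA: "emeasure P ?A = ennreal (q x \<psi>)" .
    have "T = (\<integral>\<^sup>+\<theta>. ennreal (truncated_loss \<Psi> p \<eta> \<theta> \<psi>) + ennreal (1 / max \<eta> (p \<psi>)) * indicator ?A \<theta> \<partial>P)"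
      unfolding T_def by (intro nn_integral_cong) (auto simp: truncated_loss_def indicator_def)
    also have "\<dots> = ?R + ennreal (1 / max \<eta> (p \<psi>)) * emeasure P ?A"
    proof -
      have "(\<lambda>\<theta>. ennreal (truncated_loss \<Psi> p \<eta> \<theta> \<psi>)) \<in> borel_measurable P"
        using measurable_compose[OF \<Psi>P meas[of "\<lambda>y. of_bool (y \<noteq> \<psi>) / max \<eta> (p y)"]]
        by (simp add: truncated_loss_def)
      then show ?thesis using A by (subst nn_integral_add) (auto simp: nn_integral_cmult_indicator)
    qed
    also have "ennreal (1 / max \<eta> (p \<psi>)) * emeasure P ?A = ennreal (r \<psi>)"
      unfolding eA r_def using \<eta> q_nonneg[OF x(1) \<psi>] by (simp flip: ennreal_mult add: max_def)
    finally have TR: "T = ?R + ennreal (r \<psi>)" .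
    then obtain R where R: "?R = ennreal R" "0 \<le> R" using Tfin by (cases ?R) auto
    have r0: "0 \<le> r \<psi>" using \<eta> q_nonneg[OF x(1) \<psi>] by (simp add: r_def)
    have "ennreal K = ennreal (R + r \<psi>)" using TR TK R r0 by simp
    then have "K = R + r \<psi>" using R r0 K0 by (simp del: ennreal_plus)
    then show ?thesis using R by (simp add: posterior_risk_def enn2ereal_ennreal)
  qed
  have sQ: "space Q = space \<nu>\<Psi>" by (simp add: Q_def)
  let ?S = "{k. measure Q {\<psi> \<in> space \<nu>\<Psi>. r \<psi> \<ge> k} \<ge> \<gamma>}"
  have "{k. measure Q {\<psi> \<in> space Q. posterior_risk P (truncated_loss \<Psi> p \<eta>) \<psi> \<le> ereal k} \<ge> \<gamma>}
     = {k. K - k \<in> ?S}"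
  proof -
    have "{\<psi> \<in> space Q. posterior_risk P (truncated_loss \<Psi> p \<eta>) \<psi> \<le> ereal k} =
       {\<psi> \<in> space \<nu>\<Psi>. K - k \<le> r \<psi>}" for k
      using sQ risk by auto
    then show ?thesis by simp
  qed
  also have "\<dots> = (\<lambda>k. K - k) ` ?S"
    by (auto simp: image_iff) (metis diff_diff_eq2 add_diff_cancel_left')
  finally have "lowest_posterior_loss_cutoff P Q (truncated_loss \<Psi> p \<eta>) \<gamma> = ereal K - Sup (ereal ` ?S)"
    by (simp only: lowest_posterior_loss_cutoff_def ereal_refl_Inf)
  moreover have "ereal (K - r \<psi>) \<le> ereal K - Z \<longleftrightarrow> Z \<le> ereal (r \<psi>)" for Z \<psi>
    by (cases Z) auto
  ultimately show ?thesis
    unfolding lowest_posterior_loss_region_def using sQ risk by auto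
qed

end

theory Submission
  imports Defs
begin

text \<open>
  Write \<open>r \<psi> = q \<psi> / p \<psi>\<close> for the relative belief ratio and
  \<open>r\<^sub>\<eta> \<psi> = q \<psi> / max \<eta> (p \<psi>)\<close> for its truncation. The posterior risk of reporting
  \<open>\<psi>\<close> under the truncated loss is \<open>K - r\<^sub>\<eta> \<psi>\<close> for a constant \<open>K\<close> (which depends on \<open>\<eta>\<close>), so the
  lowest posterior loss region is a relative surprise region in which the prior density \<open>p\<close> is replaced by \<open>max \<eta> p\<close>. Everything
  then follows from comparing \<open>r\<^sub>\<eta>\<close> with \<open>r\<close>: always \<open>r\<^sub>\<eta> \<le> r\<close>, with equality at \<open>\<psi>\<close> as soon as
  \<open>\<eta> \<le> p \<psi>\<close>.

  For the lower limit, \<open>r\<^sub>\<eta> \<le> r\<close> makes the truncated cutoff at most the original one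
  (\<open>relative_surprise_cutoff_antimono\<close>). The ratio at a point of the original region thus
  reaches the truncated cutoff once \<open>\<eta>\<close> is below the prior mass of the point, because from there on the ratio is no longer truncated.

  For the upper limit, let \<open>\<psi>\<close> lie outside the region of the larger content \<open>\<gamma>'\<close>. Some level
  \<open>k > r \<psi>\<close> then still has \<open>Q {r \<ge> k} \<ge> \<gamma>' > \<gamma>\<close>. As \<open>p > 0\<close> everywhere, the sets
  \<open>{r \<ge> k} \<inter> {p \<ge> \<eta>}\<close> increase to \<open>{r \<ge> k}\<close> when \<open>\<eta>\<close> decreases to \<open>0\<close>, and they are contained in
  \<open>{r\<^sub>\<eta> \<ge> k}\<close>. Continuity from below gives \<open>Q {r\<^sub>\<eta> \<ge> k} \<ge> \<gamma>\<close> for all small \<open>\<eta>\<close>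
  (\<open>truncated_superlevel_content\<close>), so the truncated cutoff is at least \<open>k > r \<psi> \<ge> r\<^sub>\<eta> \<psi>\<close>,
  which keeps \<open>\<psi>\<close> out of every truncated region with \<open>\<eta>\<close> small. The strict gap between \<open>\<gamma>\<close> and \<open>\<gamma>'\<close> is what absorbs the
  loss of content under truncation.
\<close>

lemma truncated_ratio_le:
  fixes a b \<eta> :: real
  assumes "0 \<le> a" "0 < b"
  shows "a / max \<eta> b \<le> a / b"
  using assms by (intro divide_left_mono) auto

lemma relative_surprise_cutoff_antimono:
  assumes "finite_measure Q" and sets: "sets Q = Pow (space Q)"
    and le: "\<And>\<psi>. \<psi> \<in> space Q \<Longrightarrow> q \<psi> / p' \<psi> \<le> q \<psi> / p \<psi>"
  shows "relative_surprise_cutoff Q p' q \<gamma> \<le> relative_surprise_cutoff Q p q \<gamma>"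
proof -
  interpret finite_measure Q by fact
  have "measure Q {\<psi> \<in> space Q. k \<le> q \<psi> / p' \<psi>} \<le> measure Q {\<psi> \<in> space Q. k \<le> q \<psi> / p \<psi>}" for k
    using le by (intro finite_measure_mono) (auto simp: sets intro: order_trans)
  then show ?thesis
    unfolding relative_surprise_cutoff_def
    by (intro Sup_subset_mono image_mono) (auto intro: order_trans)
qed

lemma relative_surprise_region_subset_liminf:
  assumes "finite_measure Q" "sets Q = Pow (space Q)"
    and q: "\<And>\<psi>. \<psi> \<in> space Q \<Longrightarrow> 0 \<le> q \<psi>" and p: "\<And>\<psi>. \<psi> \<in> space Q \<Longrightarrow> 0 < p \<psi>"
  shows "relative_surprise_region Q p q \<gamma>
    \<subseteq> set_liminf0 (\<lambda>\<eta>. relative_surprise_region Q (\<lambda>\<psi>. max \<eta> (p \<psi>)) q \<gamma>)"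
proof
  fix \<psi> assume \<psi>: "\<psi> \<in> relative_surprise_region Q p q \<gamma>"
  then have sp: "\<psi> \<in> space Q" by (simp add: relative_surprise_region_def)
  have "\<psi> \<in> relative_surprise_region Q (\<lambda>\<psi>. max \<eta> (p \<psi>)) q \<gamma>" if "\<eta> \<in> {0<..<p \<psi>}" for \<eta>
  proof -
    have "relative_surprise_cutoff Q (\<lambda>\<psi>. max \<eta> (p \<psi>)) q \<gamma> \<le> relative_surprise_cutoff Q p q \<gamma>"
      using assms by (intro relative_surprise_cutoff_antimono truncated_ratio_le) auto
    moreover have "max \<eta> (p \<psi>) = p \<psi>" using that by simp
    ultimately show ?thesis using \<psi> by (auto simp: relative_surprise_region_def)
  qed
  then show "\<psi> \<in> set_liminf0 (\<lambda>\<eta>. relative_surprise_region Q (\<lambda>\<psi>. max \<eta> (p \<psi>)) q \<gamma>)"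
    unfolding set_liminf0_def using p[OF sp] by (auto intro!: bexI[of _ "p \<psi>"])
qed

text \<open>
  The threshold \<open>\<eta>0\<close> has the form \<open>1 / (n + 1)\<close>, which turns the family \<open>{r \<ge> k} \<inter> {p \<ge> \<eta>}\<close> into an
  increasing sequence; smaller \<open>\<eta>\<close> only enlarge the set on which nothing is truncated, so the bound
  persists below \<open>\<eta>0\<close>.
\<close>
lemma truncated_superlevel_content:
  fixes p q :: "'a \<Rightarrow> real"
  assumes "finite_measure Q" and sets: "sets Q = Pow (space Q)"
    and p: "\<And>\<psi>. \<psi> \<in> space Q \<Longrightarrow> 0 < p \<psi>"
    and less: "\<gamma> < measure Q {\<psi> \<in> space Q. k \<le> q \<psi> / p \<psi>}"
  obtains \<eta>0 where "0 < \<eta>0"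
    "\<And>\<eta>. \<eta> < \<eta>0 \<Longrightarrow> \<gamma> < measure Q {\<psi> \<in> space Q. k \<le> q \<psi> / max \<eta> (p \<psi>)}"
proof -
  interpret finite_measure Q by fact
  define A where "A n = {\<psi> \<in> space Q. k \<le> q \<psi> / p \<psi> \<and> inverse (real (Suc n)) \<le> p \<psi>}" for n
  have mono: "incseq A"
  proof (rule incseq_SucI)
    fix n
    have "inverse (real (Suc (Suc n))) \<le> inverse (real (Suc n))"
      by (intro le_imp_inverse_le) auto
    then show "A n \<subseteq> A (Suc n)" unfolding A_def by (blast intro: order_trans)
  qed
  have "(\<lambda>n. measure Q (A n)) \<longlonglongrightarrow> measure Q (\<Union>n. A n)"
    by (intro finite_Lim_measure_incseq mono) (auto simp: sets A_def)
  also have "(\<Union>n. A n) = {\<psi> \<in> space Q. k \<le> q \<psi> / p \<psi>}"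
  proof -
    have "\<exists>n. inverse (real (Suc n)) \<le> p \<psi>" if "\<psi> \<in> space Q" for \<psi>
      using reals_Archimedean[OF p[OF that]] by (auto intro: less_imp_le)
    then show ?thesis by (auto simp: A_def)
  qed
  finally have "\<forall>\<^sub>F n in sequentially. \<gamma> < measure Q (A n)"
    using less by (rule order_tendstoD(1))
  then obtain n where n: "\<gamma> < measure Q (A n)"
    by (auto simp: eventually_sequentially)
  show thesis
  proof (rule that)
    fix \<eta> assume "\<eta> < inverse (real (Suc n))"
    then have "A n \<subseteq> {\<psi> \<in> space Q. k \<le> q \<psi> / max \<eta> (p \<psi>)}"
      by (auto simp: A_def max_def)
    then have "measure Q (A n) \<le> measure Q {\<psi> \<in> space Q. k \<le> q \<psi> / max \<eta> (p \<psi>)}"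
      by (intro finite_measure_mono) (auto simp: sets)
    with n show "\<gamma> < measure Q {\<psi> \<in> space Q. k \<le> q \<psi> / max \<eta> (p \<psi>)}" by simp
  qed simp
qed

lemma limsup_subset_relative_surprise_region:
  assumes "finite_measure Q" "sets Q = Pow (space Q)"
    and q: "\<And>\<psi>. \<psi> \<in> space Q \<Longrightarrow> 0 \<le> q \<psi>" and p: "\<And>\<psi>. \<psi> \<in> space Q \<Longrightarrow> 0 < p \<psi>"
    and "\<gamma> < \<gamma>'"
  shows "set_limsup0 (\<lambda>\<eta>. relative_surprise_region Q (\<lambda>\<psi>. max \<eta> (p \<psi>)) q \<gamma>)
    \<subseteq> relative_surprise_region Q p q \<gamma>'"
proof
  fix \<psi> assume \<psi>: "\<psi> \<in> set_limsup0 (\<lambda>\<eta>. relative_surprise_region Q (\<lambda>\<psi>. max \<eta> (p \<psi>)) q \<gamma>)"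
  have inf_often: "\<exists>\<eta>\<in>{0<..<\<eta>0}. \<psi> \<in> relative_surprise_region Q (\<lambda>\<psi>. max \<eta> (p \<psi>)) q \<gamma>"
    if "0 < \<eta>0" for \<eta>0
    using \<psi> that by (auto simp: set_limsup0_def)
  from inf_often[OF zero_less_one] have sp: "\<psi> \<in> space Q"
    by (auto simp: relative_surprise_region_def)
  show "\<psi> \<in> relative_surprise_region Q p q \<gamma>'"
  proof (rule ccontr)
    assume "\<psi> \<notin> relative_surprise_region Q p q \<gamma>'"
    then have "ereal (q \<psi> / p \<psi>) < relative_surprise_cutoff Q p q \<gamma>'"
      using sp by (simp add: relative_surprise_region_def not_le)
    then obtain k where k: "q \<psi> / p \<psi> < k" "\<gamma>' \<le> measure Q {\<psi> \<in> space Q. k \<le> q \<psi> / p \<psi>}"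
      unfolding relative_surprise_cutoff_def less_Sup_iff by auto
    have "\<gamma> < measure Q {\<psi> \<in> space Q. k \<le> q \<psi> / p \<psi>}"
      using k(2) \<open>\<gamma> < \<gamma>'\<close> by simp
    from truncated_superlevel_content[OF assms(1,2) p this]
    obtain \<eta>0 where \<eta>0: "0 < \<eta>0"
      "\<And>\<eta>. \<eta> < \<eta>0 \<Longrightarrow> \<gamma> < measure Q {\<psi> \<in> space Q. k \<le> q \<psi> / max \<eta> (p \<psi>)}"
      by blast
    obtain \<eta> where \<eta>: "\<eta> < \<eta>0" "\<psi> \<in> relative_surprise_region Q (\<lambda>\<psi>. max \<eta> (p \<psi>)) q \<gamma>"
      using inf_often[OF \<eta>0(1)] by auto
    have "ereal k \<le> relative_surprise_cutoff Q (\<lambda>\<psi>. max \<eta> (p \<psi>)) q \<gamma>"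
      unfolding relative_surprise_cutoff_def using \<eta>0(2)[OF \<eta>(1)] by (intro Sup_upper) auto
    also have "\<dots> \<le> ereal (q \<psi> / max \<eta> (p \<psi>))"
      using \<eta>(2) by (simp add: relative_surprise_region_def)
    also have "\<dots> \<le> ereal (q \<psi> / p \<psi>)"
      using truncated_ratio_le[OF q[OF sp] p[OF sp]] by simp
    finally show False using k(1) by simp
  qed
qed

lemma (in bayes_model) prob_space_posterior:
  assumes x: "x \<in> space \<mu>" "0 < prior_predictive \<nu> w f x" "prior_predictive \<nu> w f x < \<infinity>"
  shows "prob_space (posterior \<nu> w f x)"
proof
  have m: "(\<lambda>\<theta>. ennreal (w \<theta> * f \<theta> x)) \<in> borel_measurable \<nu>"
    using w_measurable f_measurable_param[OF x(1)] by measurable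
  then show "emeasure (posterior \<nu> w f x) (space (posterior \<nu> w f x)) = 1"
    using x unfolding posterior_def
    by (simp add: emeasure_density prior_predictive_def[symmetric] nn_integral_divide
        ennreal_divide_self cong: nn_integral_cong)
qed

theorem theorem9:
  fixes \<mu> :: "'x measure"
    and f :: "'t \<Rightarrow> 'x \<Rightarrow> real"
    and \<nu> :: "'t measure"
    and w :: "'t \<Rightarrow> real"
    and \<nu>\<Psi> :: "'p measure"
    and \<Psi> :: "'t \<Rightarrow> 'p"
    and p :: "'p \<Rightarrow> real"
    and q :: "'x \<Rightarrow> 'p \<Rightarrow> real"
    and x :: 'x
  defines "P \<equiv> posterior \<nu> w f x"
  defines "Q \<equiv> distr P \<nu>\<Psi> \<Psi>"
  defines "C \<equiv> relative_surprise_region Q p (q x)"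
  defines "LPL \<equiv> \<lambda>\<gamma> \<eta>. lowest_posterior_loss_region P Q (truncated_loss \<Psi> p \<eta>) \<gamma>"
  assumes "bayes_model \<mu> f \<nu> w \<nu>\<Psi> \<Psi> p q"
    and "countable (space \<nu>\<Psi>)"
    and "\<nu>\<Psi> = count_space (space \<nu>\<Psi>)"
    and "\<And>\<psi>. \<psi> \<in> space \<nu>\<Psi> \<Longrightarrow> 0 < p \<psi>"
    and "x \<in> space \<mu>"
    and "0 < prior_predictive \<nu> w f x"
    and "prior_predictive \<nu> w f x < \<infinity>"
  shows "(\<forall>\<gamma>\<in>{0..1}. measure Q (C \<gamma>) = \<gamma> \<longrightarrow> C \<gamma> \<subseteq> set_liminf0 (LPL \<gamma>)) \<and>
    (\<forall>\<gamma>\<in>{0..1}. \<forall>\<gamma>'\<in>{0..1}. \<gamma> < \<gamma>' \<and> measure Q (C \<gamma>') = \<gamma>' \<longrightarrow>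
       set_limsup0 (LPL \<gamma>) \<subseteq> C \<gamma>')"
proof -
  interpret bayes_model \<mu> f \<nu> w \<nu>\<Psi> \<Psi> p q by fact
  have "\<Psi> \<in> measurable P \<nu>\<Psi>"
    using \<Psi>_measurable by (simp add: P_def posterior_def)
  then interpret Q: prob_space Q
    unfolding Q_def using prob_space_posterior[OF assms(9-11)]
    by (simp add: P_def prob_space.prob_space_distr)
  have fin: "finite_measure Q" by unfold_locales
  have spQ: "space Q = space \<nu>\<Psi>" by (simp add: Q_def)
  have "sets \<nu>\<Psi> = Pow (space \<nu>\<Psi>)"
    by (subst (1) assms(7)) simp
  then have sets: "sets Q = Pow (space Q)" by (simp add: Q_def)
  have q: "0 \<le> q x \<psi>" if "\<psi> \<in> space Q" for \<psi>
    using q_nonneg[OF assms(9)] that by (simp add: spQ)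
  have p: "0 < p \<psi>" if "\<psi> \<in> space Q" for \<psi>
    using assms(8) that by (simp add: spQ)
  have LPL: "LPL \<gamma> \<eta> = relative_surprise_region Q (\<lambda>\<psi>. max \<eta> (p \<psi>)) (q x) \<gamma>"
    if "0 < \<eta>" for \<gamma> \<eta>
    using lowest_posterior_loss_region_truncated[OF assms(7,9-11) that]
    by (simp add: LPL_def relative_surprise_region_def relative_surprise_cutoff_def Q_def P_def)
  \<comment> \<open>The limits at \<open>0\<close> only see positive \<open>\<eta>\<close>, where the explicit form of the region is valid.\<close>
  have "set_liminf0 (LPL \<gamma>) = set_liminf0 (\<lambda>\<eta>. relative_surprise_region Q (\<lambda>\<psi>. max \<eta> (p \<psi>)) (q x) \<gamma>)"
    "set_limsup0 (LPL \<gamma>) = set_limsup0 (\<lambda>\<eta>. relative_surprise_region Q (\<lambda>\<psi>. max \<eta> (p \<psi>)) (q x) \<gamma>)" for \<gamma>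
    by (auto simp: set_liminf0_def set_limsup0_def LPL cong: INF_cong SUP_cong)
  then show ?thesis
    using relative_surprise_region_subset_liminf[OF fin sets q p]
      limsup_subset_relative_surprise_region[OF fin sets q p]
    by (simp add: C_def)
qed

end
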